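(* Let $\alpha,\beta\in\mathbb{R}\setminus\mathbb{Q}$. The set of proper holomorphic mappings between the domains $D_\alpha^*$ and $D_\beta^*$ is non-empty if and only if $$\alpha=\frac{k_2+\beta l_2}{k_1+\beta l_1}$$ for some $k_i,l_i\in\mathbb{Z}$, $i=1,2$. Moreover, if $\alpha=(k_2+\beta l_2)/(k_1+\beta l_1)$, where $k_i,l_i\in\mathbb{Z}$, $i=1,2$, and $k_1+l_1\beta>0$, then any proper holomorphic mapping $f:D_\alpha^*\to D_\beta^*$ is of the form $$f(z_1,z_2)=(az_1^{k_1}z_2^{k_2},\,bz_1^{l_1}z_2^{l_2}),\quad (z_1,z_2)\in D_\alpha^*,$$ where $a,b\in\mathbb{C}$ satisfy the relation $|a||b|^{\beta}=1$.
   Context: For $\gamma\in\mathbb{R}\setminus\{0\}$, $D_\gamma^*:=\{(z_1,z_2)\in\mathbb{C}^2:\ 0<|z_1||z_2|^{\gamma}<1\}$, where only points for which the expression $|z_1||z_2|^{\gamma}$ makes sense are considered (so $z_2\neq0$ if $\gamma<0$).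
   Formalization: In the "moreover" part the exponents k_i, l_i may depend on f: they form some representation of α with k_1+l_1β>0, not necessarily the given one. With fixed exponents the claim is false (α=β, k_1=l_2=2, k_2=l_1=0, f=id). *)

theory Defs
  imports "HOL-Analysis.Analysis"
begin

text \<open>
  \<open>0 powr \<gamma> = 0\<close> for every real \<open>\<gamma>\<close>. For \<open>\<gamma> > 0\<close> this is the usual value; for \<open>\<gamma> < 0\<close> the
  expression makes no sense at \<open>z2 = 0\<close>, and those points are excluded explicitly.
\<close>

definition D_star :: "real \<Rightarrow> (complex \<times> complex) set" where
  "D_star \<gamma> = {(z1, z2). (\<gamma> < 0 \<longrightarrow> z2 \<noteq> 0) \<and>
                 0 < cmod z1 * cmod z2 powr \<gamma> \<and> cmod z1 * cmod z2 powr \<gamma> < 1}"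

text \<open>
  The library's \<open>holomorphic_on\<close> covers functions of one variable only. On an open set,
  holomorphy is Frechet differentiability with complex linear derivative at every point; the
  coefficients \<open>p, q, r, s\<close> below are the entries of the complex Jacobian matrix.
\<close>

definition holomorphic_map_on ::
    "(complex \<times> complex \<Rightarrow> complex \<times> complex) \<Rightarrow> (complex \<times> complex) set \<Rightarrow> bool" where
  "holomorphic_map_on f U \<longleftrightarrow>
     (\<forall>z\<in>U. \<exists>p q r s. (f has_derivative (\<lambda>(u, v). (p * u + q * v, r * u + s * v))) (at z))"

definition proper_holomorphic ::
    "(complex \<times> complex) set \<Rightarrow> (complex \<times> complex) set \<Rightarrow>
     (complex \<times> complex \<Rightarrow> complex \<times> complex) \<Rightarrow> bool" where
  "proper_holomorphic U V f \<longleftrightarrow>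
     holomorphic_map_on f U \<and> proper_map (top_of_set U) (top_of_set V) f"

lemma open_D_star: "open (D_star \<gamma>)"
proof -
  let ?S = "- ((UNIV \<times> {0}) \<union> ({0} \<times> UNIV)) :: (complex \<times> complex) set"
  let ?g = "\<lambda>z :: complex \<times> complex. cmod (fst z) * cmod (snd z) powr \<gamma>"
  have eq: "D_star \<gamma> = ?S \<inter> ?g -` {..<1}"
    by (auto simp: D_star_def)
  have "open ?S"
    by (intro open_Compl closed_Un closed_Times) auto
  moreover have "continuous_on ?S ?g"
    by (intro continuous_intros) auto
  ultimately show ?thesis
    unfolding eq by (intro continuous_open_preimage) auto
qed

text \<open>The library's \<open>proper_map\<close> agrees with the definition by compact preimages.\<close>

lemma proper_holomorphic_iff_compact_preimages:
  "proper_holomorphic U V f \<longleftrightarrow>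
     holomorphic_map_on f U \<and> f \<in> U \<rightarrow> V \<and>
     (\<forall>K. K \<subseteq> V \<and> compact K \<longrightarrow> compact {z \<in> U. f z \<in> K})"
proof (cases "holomorphic_map_on f U")
  case True
  have k: "k_space (top_of_set V)"
    by (simp add: metrizable_imp_k_space metrizable_space_subtopology metrizable_space_euclidean)
  have kc: "kc_space (top_of_set W)" for W :: "(complex \<times> complex) set"
    by (simp add: Hausdorff_imp_kc_space Hausdorff_space_subtopology)
  have sub: "compactin (top_of_set W) S \<longleftrightarrow> S \<subseteq> W \<and> compact S" for W S :: "(complex \<times> complex) set"
    by (auto simp: compactin_subtopology)
  have "proper_map (top_of_set U) (top_of_set V) f \<longleftrightarrow>
        f \<in> U \<rightarrow> V \<and> (\<forall>K. K \<subseteq> V \<and> compact K \<longrightarrow> compact {z \<in> U. f z \<in> K})"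
    unfolding proper_eq_compact_map[OF k kc disjI2[OF kc]] by (auto simp: sub)
  then show ?thesis
    by (simp add: proper_holomorphic_def True)
qed (simp add: proper_holomorphic_def)

end

theory Submission
  imports Defs "HOL-Complex_Analysis.Complex_Analysis" "HOL-Real_Asymp.Real_Asymp"
begin

text \<open>
  Taking logarithms of moduli turns \<open>D_star \<gamma>\<close> into a half-plane of \<open>\<real>\<^sup>2\<close>, and taking complex logarithms
  presents it as a quotient of a half-plane times \<open>\<complex>\<close>, with coordinates \<open>w\<close> (whose real part is the
  logarithm of \<open>|z1| |z2|^\<gamma>\<close>) and \<open>s\<close> (a logarithm of \<open>z2\<close>), by a rank two lattice of translations.
  The level sets of \<open>|z1| |z2|^\<gamma>\<close> are foliated by the complex lines \<open>w = const\<close>, and for irrational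
  \<open>\<gamma>\<close> every leaf is dense in its level set.

  Let \<open>f\<close> be proper. The components of \<open>f\<close> have no zeros, so they lift to logarithms \<open>G1\<close>, \<open>G2\<close> whose
  increments under the lattice are integer multiples of \<open>2\<pi>\<i>\<close>; these integers are the exponents
  \<open>k1, k2, l1, l2\<close> (\<open>logarithm_lift\<close>). The combination \<open>G1 + \<beta> G2\<close> has negative real part, so Liouville's
  theorem makes it a function of \<open>w\<close> alone. Its increments under \<open>2\<pi>\<i>\<close> and \<open>2\<pi>\<i>\<alpha>\<close> are constant, and
  since \<open>\<alpha>\<close> is irrational this forces it to be affine, with slope \<open>k1 + \<beta> l1\<close>, and forces
  \<open>\<alpha> (k1 + \<beta> l1) = k2 + \<beta> l2\<close> (\<open>two_quasi_periods_imp_affine\<close>).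

  There remains one unknown function, the part \<open>h\<close> of \<open>G2\<close> that is invariant under the lattice.
  On a leaf it is an entire function of \<open>s\<close>, bounded on vertical strips by compactness. Properness
  says that \<open>f\<close> cannot return to the torus \<open>|z2| = 1\<close> of a level set as \<open>|Re s|\<close> grows, so
  \<open>Re G2\<close> keeps its sign on a right and on a left half-plane. The Schwarz lemma then bounds \<open>G2\<close>, hence \<open>h\<close>,
  quadratically, and \<open>h\<close> is a constant on the leaf (\<open>entire_bounded_on_strips_imp_constant\<close>).
  As a function of \<open>w\<close> it has the periods \<open>2\<pi>\<i>\<close> and \<open>2\<pi>\<i>\<alpha>\<close>, so it is constant, and \<open>f\<close> is
  monomial. The behaviour along \<open>(t, 1)\<close> as \<open>t \<rightarrow> 1\<close> gives the sign of \<open>k1 + \<beta> l1\<close> and the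
  normalization of the coefficients (\<open>proper_monomial_normalization\<close>).

  Conversely, a monomial map with these exponents acts on logarithms of moduli by an invertible
  linear map carrying one half-plane onto the other, and is therefore proper
  (\<open>proper_holomorphic_monomial\<close>).
\<close>

section \<open>Holomorphic functions with two incommensurable periods\<close>

text \<open>
  Along periods tending to \<open>0\<close> every difference quotient vanishes, hence so does the derivative.
\<close>

lemma arbitrarily_small_periods_imp_constant:
  fixes \<psi> :: "complex \<Rightarrow> complex"
  assumes S: "open S" "convex S" and hol: "\<psi> holomorphic_on S"
    and periods: "\<And>e. e > 0 \<Longrightarrow> \<exists>p. p \<noteq> 0 \<and> cmod p < e \<and> (\<forall>w\<in>S. \<psi> (w + p) = \<psi> w)"
  shows "\<psi> constant_on S"
proof -
  have "(\<psi> has_field_derivative 0) (at w)" if "w \<in> S" for w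
  proof -
    obtain D where D: "(\<psi> has_field_derivative D) (at w)"
      using holomorphic_derivI[OF hol S(1) \<open>w \<in> S\<close>] by blast
    then have lim: "((\<lambda>p. (\<psi> (w + p) - \<psi> w) / p) \<longlongrightarrow> D) (at 0)"
      by (simp add: DERIV_def)
    have "D = 0"
    proof (rule ccontr)
      assume "D \<noteq> 0"
      then have "\<forall>\<^sub>F p in at 0. (\<psi> (w + p) - \<psi> w) / p \<noteq> 0"
        using tendsto_imp_eventually_ne[OF lim] by blast
      then obtain e where "e > 0" and e: "\<And>p. p \<noteq> 0 \<Longrightarrow> cmod p < e \<Longrightarrow> (\<psi> (w + p) - \<psi> w) / p \<noteq> 0"
        by (auto simp: eventually_at dist_norm)
      with periods[OF \<open>e > 0\<close>] that show False by fastforce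
    qed
    with D show ?thesis by simp
  qed
  then have "\<exists>c. \<forall>w\<in>S. \<psi> w = c"
    by (intro has_field_derivative_zero_constant[OF S(2)]) (simp add: has_field_derivative_at_within)
  then show ?thesis by (auto simp: constant_on_def)
qed

lemma small_integer_combination:
  fixes \<alpha> e :: real
  assumes "\<alpha> \<notin> \<rat>" "e > 0"
  obtains m n :: int where "0 < of_int n * \<alpha> + of_int m" "of_int n * \<alpha> + of_int m < e"
proof -
  obtain h k where "\<bar>of_int k * \<alpha> - of_int h - e/2\<bar> < e/2"
    using sequence_of_fractional_parts_is_dense[of \<alpha> "e/2" "e/2"] assms half_gt_zero by metis
  then have "0 < of_int k * \<alpha> - of_int h" "of_int k * \<alpha> - of_int h < e" by linarith+
  then show thesis using that[of k "-h"] by simp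
qed

lemma open_left_half_plane: "open {w :: complex. Re w < 0}"
  using open_halfspace_Re_lt .

lemma convex_left_half_plane: "convex {w :: complex. Re w < 0}"
  using convex_halfspace_Re_lt .

lemma iterate_period:
  fixes \<psi> :: "'a::real_vector \<Rightarrow> 'b"
  assumes inv: "\<And>x. x + p \<in> S \<longleftrightarrow> x \<in> S" and step: "\<And>x. x \<in> S \<Longrightarrow> \<psi> (x + p) = \<psi> x"
    and "x \<in> S"
  shows "x + of_int n *\<^sub>R p \<in> S" "\<psi> (x + of_int n *\<^sub>R p) = \<psi> x"
proof -
  have "x + of_int n *\<^sub>R p \<in> S \<and> \<psi> (x + of_int n *\<^sub>R p) = \<psi> x"
  proof (induction n rule: int_induct[of _ 0])
    case base
    show ?case using \<open>x \<in> S\<close> by simp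
  next
    case (step1 i)
    have "x + of_int (i + 1) *\<^sub>R p = (x + of_int i *\<^sub>R p) + p"
      by (simp add: algebra_simps)
    then show ?case using step1 inv step by metis
  next
    case (step2 i)
    have "x + of_int i *\<^sub>R p = (x + of_int (i - 1) *\<^sub>R p) + p"
      by (simp add: algebra_simps)
    then show ?case using step2 inv step by metis
  qed
  then show "x + of_int n *\<^sub>R p \<in> S" "\<psi> (x + of_int n *\<^sub>R p) = \<psi> x" by auto
qed

lemma two_periods_imp_constant:
  fixes \<psi> :: "complex \<Rightarrow> complex" and \<alpha> :: real
  assumes irr: "\<alpha> \<notin> \<rat>" and hol: "\<psi> holomorphic_on {w. Re w < 0}"
    and p1: "\<And>w. Re w < 0 \<Longrightarrow> \<psi> (w + 2 * pi * \<i>) = \<psi> w"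
    and p2: "\<And>w. Re w < 0 \<Longrightarrow> \<psi> (w + 2 * pi * \<i> * \<alpha>) = \<psi> w"
  shows "\<psi> constant_on {w. Re w < 0}"
proof (rule arbitrarily_small_periods_imp_constant[OF open_left_half_plane convex_left_half_plane hol])
  fix e :: real assume "e > 0"
  then obtain m n :: int where mn: "0 < of_int n * \<alpha> + of_int m" "of_int n * \<alpha> + of_int m < e / (2 * pi)"
    using small_integer_combination[OF irr] by (metis divide_pos_pos pi_gt_zero mult_pos_pos zero_less_numeral)
  define p where "p = of_int n * (2 * pi * \<i> * \<alpha>) + of_int m * (2 * pi * \<i>)"
  have p: "p = \<i> * complex_of_real (2 * pi * (of_int n * \<alpha> + of_int m))"
    by (simp add: p_def algebra_simps)
  have "\<psi> (w + p) = \<psi> w" if w: "w \<in> {w. Re w < 0}" for w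
  proof -
    let ?w = "w + of_int n *\<^sub>R (2 * pi * \<i> * \<alpha>)"
    have "?w \<in> {w. Re w < 0}" "\<psi> ?w = \<psi> w"
      using iterate_period[of "2 * pi * \<i> * \<alpha>" "{w. Re w < 0}" \<psi> w n] p2 w by auto
    moreover from this have "\<psi> (?w + of_int m *\<^sub>R (2 * pi * \<i>)) = \<psi> ?w"
      using iterate_period[of "2 * pi * \<i>" "{w. Re w < 0}" \<psi> ?w m] p1 by auto
    ultimately show ?thesis by (simp add: p_def add.assoc scaleR_conv_of_real)
  qed
  moreover have "p \<noteq> 0" using mn by (simp add: p del: of_real_add of_real_mult)
  moreover have "cmod p < e"
    using mn by (simp add: p norm_mult abs_mult pos_less_divide_eq mult.commute
        del: of_real_add of_real_mult)
  ultimately show "\<exists>p. p \<noteq> 0 \<and> cmod p < e \<and> (\<forall>w\<in>{w. Re w < 0}. \<psi> (w + p) = \<psi> w)" by blast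
qed

text \<open>
  The derivative has the two periods \<open>2\<pi>\<i>\<close> and \<open>2\<pi>\<i>\<alpha>\<close>, so it is constant; comparing increments then
  ties the two constants \<open>A\<close> and \<open>B\<close> to the slope. This is where the relation between \<open>\<alpha>\<close> and
  \<open>\<beta>\<close> comes from: \<open>A\<close> and \<open>B\<close> will be \<open>2\<pi>\<i>(k1 + \<beta> l1)\<close> and \<open>2\<pi>\<i>(k2 + \<beta> l2)\<close>.
\<close>

lemma two_quasi_periods_imp_affine:
  fixes \<phi> :: "complex \<Rightarrow> complex" and \<alpha> :: real and A B :: complex
  assumes irr: "\<alpha> \<notin> \<rat>" and hol: "\<phi> holomorphic_on {w. Re w < 0}"
    and p1: "\<And>w. Re w < 0 \<Longrightarrow> \<phi> (w + 2 * pi * \<i>) = \<phi> w + A"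
    and p2: "\<And>w. Re w < 0 \<Longrightarrow> \<phi> (w + 2 * pi * \<i> * \<alpha>) = \<phi> w + B"
  obtains c d where "\<And>w. Re w < 0 \<Longrightarrow> \<phi> w = c * w + d" "A = 2 * pi * \<i> * c" "B = \<alpha> * A"
proof -
  let ?H = "{w :: complex. Re w < 0}"
  have deriv: "(\<phi> has_field_derivative deriv \<phi> w) (at w)" if "Re w < 0" for w
    using holomorphic_derivI[OF hol open_left_half_plane] that by auto
  have per: "deriv \<phi> (w + p) = deriv \<phi> w"
    if p: "Re p = 0" "\<And>w. Re w < 0 \<Longrightarrow> \<phi> (w + p) = \<phi> w + C" and w: "Re w < 0" for p C w
  proof -
    have "((\<lambda>w. \<phi> (w + p)) has_field_derivative deriv \<phi> (w + p)) (at w)"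
      using deriv[of "w + p"] p(1) w DERIV_shift by (metis add.right_neutral plus_complex.sel(1))
    moreover have "((\<lambda>w. \<phi> w + C) has_field_derivative deriv \<phi> w) (at w)"
      using deriv[OF w] by (auto intro!: derivative_eq_intros)
    then have "((\<lambda>w. \<phi> (w + p)) has_field_derivative deriv \<phi> w) (at w)"
      by (rule has_field_derivative_transform_within_open[OF _ open_left_half_plane]) (use w p in auto)
    ultimately show ?thesis using DERIV_unique by blast
  qed
  have "deriv \<phi> holomorphic_on ?H"
    using hol open_left_half_plane by (rule holomorphic_deriv)
  then have "deriv \<phi> constant_on ?H"
    using two_periods_imp_constant[OF irr] per[OF _ p1] per[OF _ p2] by simp
  then obtain c where c: "\<And>w. Re w < 0 \<Longrightarrow> deriv \<phi> w = c"
    by (auto simp: constant_on_def)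
  have "\<exists>d. \<forall>w\<in>?H. \<phi> w - c * w = d"
  proof (rule has_field_derivative_zero_constant[OF convex_left_half_plane])
    fix w :: complex assume "w \<in> ?H"
    then show "((\<lambda>w. \<phi> w - c * w) has_field_derivative 0) (at w within ?H)"
      using DERIV_diff[OF deriv[of w] DERIV_cmult_Id[of c]] c[of w]
      by (simp add: has_field_derivative_at_within)
  qed
  then obtain d where d: "\<And>w. Re w < 0 \<Longrightarrow> \<phi> w = c * w + d"
    by (auto simp: algebra_simps)
  have "A = 2 * pi * \<i> * c" "B = 2 * pi * \<i> * \<alpha> * c"
    \<comment> \<open>any base point in the half-plane will do\<close>
    using p1[of "-1"] p2[of "-1"] by (simp_all add: d algebra_simps)
  then show thesis using that d by (simp add: mult_ac)
qed

section \<open>Liouville-type theorems\<close>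

lemma entire_Re_negative_imp_constant:
  assumes hol: "u holomorphic_on UNIV" and neg: "\<And>s. Re (u s) < 0"
  shows "u s = u t"
proof -
  have "bounded (range (\<lambda>s. exp (u s)))"
    by (rule boundedI[of _ 1]) (use neg in \<open>auto simp: less_imp_le\<close>)
  moreover have "(\<lambda>s. exp (u s)) holomorphic_on UNIV"
    using hol by (intro holomorphic_intros)
  ultimately have "(\<lambda>s. exp (u s)) constant_on UNIV"
    using Liouville_theorem by blast
  then obtain C where C: "\<And>s. exp (u s) = C" by (auto simp: constant_on_def)
  have "(u has_field_derivative 0) (at x)" for x
  proof -
    obtain D where D: "(u has_field_derivative D) (at x)"
      using hol holomorphic_derivI by blast
    then have "((\<lambda>s. exp (u s)) has_field_derivative exp (u x) * D) (at x)"
      by (auto intro!: derivative_eq_intros)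
    moreover have "((\<lambda>s. exp (u s)) has_field_derivative 0) (at x)"
      by (simp add: C)
    ultimately have "exp (u x) * D = 0" using DERIV_unique by blast
    with D show ?thesis by simp
  qed
  then show ?thesis
    using has_field_derivative_zero_constant[of UNIV u] by force
qed

text \<open>
  Conjugating \<open>g\<close> with the Cayley transforms that send \<open>1\<close> and \<open>g 1\<close> to the centre of the disc gives a
  self-map \<open>F\<close> of the disc fixing \<open>0\<close>. The Schwarz lemma says that \<open>g s\<close> is hyperbolically no farther
  from \<open>g 1\<close> than \<open>s\<close> is from \<open>1\<close>, and in Euclidean terms this is a growth bound.
\<close>

lemma half_plane_self_map_growth:
  fixes g :: "complex \<Rightarrow> complex"
  assumes hol: "g holomorphic_on {s. Re s > 0}" and pos: "\<And>s. Re s > 0 \<Longrightarrow> Re (g s) > 0"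
    and s: "Re s > 0"
  shows "cmod (g s) \<le> cmod (g 1) * (cmod (s + 1))\<^sup>2 / Re s"
proof -
  \<comment> \<open>inverse of the Cayley transform \<open>s \<mapsto> (s - 1) / (s + 1)\<close>\<close>
  define \<sigma> where "\<sigma> = (\<lambda>\<zeta> :: complex. (1 + \<zeta>) / (1 - \<zeta>))"
  define F where "F = (\<lambda>\<zeta>. (g (\<sigma> \<zeta>) - g 1) / (g (\<sigma> \<zeta>) + cnj (g 1)))"
  have norm_lt: "cmod (x - y) < cmod (x + cnj y)" if "Re x > 0" "Re y > 0" for x y
  proof -
    have "(cmod (x + cnj y))\<^sup>2 - (cmod (x - y))\<^sup>2 = 4 * (Re x * Re y)"
      unfolding cmod_power2 by (simp add: power2_eq_square algebra_simps)
    with mult_pos_pos[OF that] have "(cmod (x - y))\<^sup>2 < (cmod (x + cnj y))\<^sup>2" by linarith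
    then show ?thesis by (rule power2_less_imp_less) simp
  qed
  have \<sigma>: "Re (\<sigma> \<zeta>) > 0" if "cmod \<zeta> < 1" for \<zeta>
  proof -
    have "\<zeta> \<noteq> 1" using that by auto
    have "(Re \<zeta>)\<^sup>2 + (Im \<zeta>)\<^sup>2 < 1"
      using abs_square_less_1[of "cmod \<zeta>"] that by (simp add: cmod_power2)
    then have "(1 + Re \<zeta>) * (1 - Re \<zeta>) - Im \<zeta> * Im \<zeta> > 0"
      by (simp add: power2_eq_square algebra_simps)
    moreover have "(1 - Re \<zeta>)\<^sup>2 + (Im \<zeta>)\<^sup>2 > 0"
      using \<open>\<zeta> \<noteq> 1\<close> by (auto simp: complex_eq_iff sum_power2_gt_zero_iff)
    ultimately show ?thesis
      by (auto simp: \<sigma>_def Re_divide intro!: divide_pos_pos)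
  qed
  have \<sigma>_hol: "\<sigma> holomorphic_on ball 0 1"
    unfolding \<sigma>_def by (intro holomorphic_intros) auto
  have g\<sigma>: "(\<lambda>\<zeta>. g (\<sigma> \<zeta>)) holomorphic_on ball 0 1"
    using holomorphic_on_compose_gen[OF \<sigma>_hol hol] \<sigma>
    by (simp add: o_def image_subset_iff)
  have ne: "x + cnj y \<noteq> 0" if "Re x > 0" "Re y > 0" for x y
    using norm_lt[OF that] by auto
  have g1: "Re (g 1) > 0" using pos[of 1] by simp
  have "F holomorphic_on ball 0 1"
    unfolding F_def using g\<sigma> ne pos \<sigma> g1 by (intro holomorphic_intros) auto
  moreover have "F 0 = 0" by (simp add: F_def \<sigma>_def)
  moreover have "cmod (F \<zeta>) < 1" if "cmod \<zeta> < 1" for \<zeta>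
    using norm_lt[OF pos[OF \<sigma>[OF that]] g1] ne[OF pos[OF \<sigma>[OF that]] g1]
    by (simp add: F_def norm_divide)
  ultimately have schwarz: "cmod (F \<zeta>) \<le> cmod \<zeta>" if "cmod \<zeta> < 1" for \<zeta>
    using Schwarz_Lemma(1) that by blast
  define \<zeta> where "\<zeta> = (s - 1) / (s + 1)"
  have s1: "s + 1 \<noteq> 0" using s by (auto simp: complex_eq_iff)
  have "cmod (s - 1) < cmod (s + 1)" using norm_lt[of s 1] s by simp
  then have \<zeta>1: "cmod \<zeta> < 1" using s1 by (simp add: \<zeta>_def norm_divide)
  have "1 - \<zeta> = 2 / (s + 1)" "1 + \<zeta> = 2 * s / (s + 1)"
    using s1 by (simp_all add: \<zeta>_def field_simps)
  then have \<sigma>\<zeta>: "\<sigma> \<zeta> = s" using s1 by (simp add: \<sigma>_def)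
  have "g s * (1 - F \<zeta>) = g 1 + cnj (g 1) * F \<zeta>"
    using ne[OF pos[OF s] g1] by (simp add: F_def \<sigma>\<zeta> field_simps)
  then have "cmod (g s) * cmod (1 - F \<zeta>) \<le> cmod (g 1) + cmod (g 1) * cmod (F \<zeta>)"
    by (metis complex_mod_cnj norm_mult norm_triangle_ineq)
  also have "\<dots> \<le> cmod (g 1) + cmod (g 1) * 1"
    using schwarz[OF \<zeta>1] \<zeta>1 by (intro add_left_mono mult_left_mono) auto
  finally have up: "cmod (g s) * cmod (1 - F \<zeta>) \<le> 2 * cmod (g 1)" by simp
  have "2 * Re s / (cmod (s + 1))\<^sup>2 \<le> cmod (1 - F \<zeta>)"
  proof -
    have "(cmod (s + 1))\<^sup>2 - (cmod (s - 1))\<^sup>2 = 4 * Re s"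
      unfolding cmod_power2 by (simp add: power2_eq_square algebra_simps)
    moreover have "1 - (cmod \<zeta>)\<^sup>2 = ((cmod (s + 1))\<^sup>2 - (cmod (s - 1))\<^sup>2) / (cmod (s + 1))\<^sup>2"
      using s1 by (simp add: \<zeta>_def norm_divide power_divide field_simps)
    ultimately have "1 - (cmod \<zeta>)\<^sup>2 = 4 * Re s / (cmod (s + 1))\<^sup>2" by simp
    moreover have "2 * cmod \<zeta> \<le> 1 + (cmod \<zeta>)\<^sup>2"
      using sum_power2_ge_zero[of "1 - cmod \<zeta>" 0] by (simp add: power2_eq_square algebra_simps)
    then have "(1 - (cmod \<zeta>)\<^sup>2) / 2 \<le> 1 - cmod \<zeta>" by (simp add: divide_le_eq)
    moreover have "1 - cmod \<zeta> \<le> cmod (1 - F \<zeta>)"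
      using schwarz[OF \<zeta>1] norm_triangle_ineq2[of 1 "F \<zeta>"] by simp
    ultimately show ?thesis by simp
  qed
  then have "cmod (g s) * (2 * Re s / (cmod (s + 1))\<^sup>2) \<le> 2 * cmod (g 1)"
    using up by (meson mult_left_mono norm_ge_zero order_trans)
  then show ?thesis using s s1 by (simp add: field_simps)
qed

text \<open>
  By connectedness \<open>Re g\<close> keeps one sign, so up to a sign and a translation \<open>g\<close> maps the right
  half-plane to itself.
\<close>

lemma half_plane_zero_free_Re_growth:
  fixes g :: "complex \<Rightarrow> complex"
  assumes hol: "g holomorphic_on {s. Re s > R}" and ne: "\<And>s. Re s > R \<Longrightarrow> Re (g s) \<noteq> 0"
  obtains C where "\<And>s. Re s \<ge> R + 1 \<Longrightarrow> cmod (g s) \<le> C * (1 + cmod s)\<^sup>2"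
proof -
  define T where "T = (\<lambda>s. Re (g s)) ` {s. Re s > R}"
  have "connected T"
    unfolding T_def
    by (intro connected_continuous_image continuous_intros holomorphic_on_imp_continuous_on hol
        convex_connected convex_halfspace_Re_gt)
  have "0 \<notin> T" using ne by (auto simp: T_def)
  obtain \<epsilon> :: complex where \<epsilon>: "cmod \<epsilon> = 1" "\<And>s. Re s > R \<Longrightarrow> Re (\<epsilon> * g s) > 0"
  proof (cases "\<forall>x\<in>T. x > 0")
    case True
    then show thesis using that[of 1] by (auto simp: T_def)
  next
    case False
    then obtain x where x: "x \<in> T" "x < 0" using \<open>0 \<notin> T\<close> by (metis linorder_less_linear)
    have "y < 0" if "y \<in> T" for y
      using connectedD_interval[OF \<open>connected T\<close> x(1) that, of 0] x(2) \<open>0 \<notin> T\<close> by force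
    then show thesis using that[of "-1"] by (auto simp: T_def)
  qed
  let ?g = "\<lambda>s :: complex. \<epsilon> * g (s + R)"
  have "(\<lambda>s :: complex. g (s + R)) holomorphic_on {s. Re s > 0}"
    using holomorphic_on_compose_gen[of "\<lambda>s. s + R" "{s. Re s > 0}" g, OF _ hol]
    by (simp add: o_def image_subset_iff holomorphic_intros)
  then have hol': "?g holomorphic_on {s. Re s > 0}"
    by (intro holomorphic_intros)
  have growth: "cmod (g s) \<le> cmod (g (1 + R)) * (2 + \<bar>R\<bar>)\<^sup>2 * (1 + cmod s)\<^sup>2" if s: "Re s \<ge> R + 1" for s
  proof -
    have "cmod (?g (s - R)) \<le> cmod (?g 1) * (cmod (s - R + 1))\<^sup>2 / Re (s - R)"
      by (rule half_plane_self_map_growth[OF hol']) (use \<epsilon> s in auto)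
    then have "cmod (g s) \<le> cmod (g (1 + R)) * (cmod (s - R + 1))\<^sup>2 / Re (s - R)"
      by (simp add: norm_mult \<epsilon>(1))
    also have "\<dots> \<le> cmod (g (1 + R)) * (cmod (s - R + 1))\<^sup>2 / 1"
      using s by (intro divide_left_mono) auto
    also have "\<dots> \<le> cmod (g (1 + R)) * ((2 + \<bar>R\<bar>) * (1 + cmod s))\<^sup>2"
    proof -
      have "cmod (s - R + 1) \<le> cmod s + cmod (complex_of_real R) + cmod 1"
        using norm_triangle_ineq[of "s - R" 1] norm_triangle_ineq4[of s "complex_of_real R"] by linarith
      also have "\<dots> \<le> (2 + \<bar>R\<bar>) * (1 + cmod s)"
        by (simp add: algebra_simps)
      finally have "(cmod (s - R + 1))\<^sup>2 \<le> ((2 + \<bar>R\<bar>) * (1 + cmod s))\<^sup>2"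
        by (rule power_mono) simp
      then show ?thesis by (simp add: mult_left_mono)
    qed
    finally show ?thesis by (simp add: power_mult_distrib mult.assoc)
  qed
  then show thesis using that by blast
qed

lemma polynomial_bounded_on_imaginary_axis:
  fixes c :: "nat \<Rightarrow> complex"
  assumes bd: "\<And>s. Re s = 0 \<Longrightarrow> cmod (\<Sum>i\<le>n. c i * s ^ i) \<le> B"
  shows "(\<Sum>i\<le>n. c i * s ^ i) = c 0"
proof -
  have "\<forall>k. k \<noteq> 0 \<longrightarrow> k \<le> n \<longrightarrow> c k = 0"
  proof (rule ccontr)
    assume "\<not> (\<forall>k. k \<noteq> 0 \<longrightarrow> k \<le> n \<longrightarrow> c k = 0)"
    then have "\<forall>\<^sub>F z in at_infinity. B + 1 \<le> cmod (\<Sum>i\<le>n. c i * z ^ i)"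
      by (intro polyfun_extremal) auto
    then obtain M where M: "\<And>z. cmod z \<ge> M \<Longrightarrow> B + 1 \<le> cmod (\<Sum>i\<le>n. c i * z ^ i)"
      by (auto simp: eventually_at_infinity)
    have "Re (\<i> * \<bar>M\<bar>) = 0" "cmod (\<i> * \<bar>M\<bar>) \<ge> M" by (auto simp: norm_mult)
    then show False using bd[of "\<i> * \<bar>M\<bar>"] M[of "\<i> * \<bar>M\<bar>"] by linarith
  qed
  then have "(\<Sum>i\<le>n. c i * s ^ i) = (\<Sum>i\<le>n. if i = 0 then c 0 else 0)"
    by (intro sum.cong) auto
  then show ?thesis by simp
qed

text \<open>
  The growth bound controls \<open>h\<close> far to the right and far to the left, and the strip hypothesis
  controls it in between, so \<open>h\<close> grows at most quadratically and is a polynomial. A polynomial that is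
  bounded on a line is constant. The linear term \<open>\<kappa> s + \<mu>\<close> is dominated by the quadratic bound.
\<close>

lemma entire_bounded_on_strips_imp_constant:
  fixes h :: "complex \<Rightarrow> complex"
  assumes hol: "h holomorphic_on UNIV"
    and strips: "\<And>M. \<exists>B. \<forall>s. \<bar>Re s\<bar> \<le> M \<longrightarrow> cmod (h s) \<le> B"
    and ne: "\<And>s. \<bar>Re s\<bar> > R \<Longrightarrow> Re (h s + \<kappa> * s + \<mu>) \<noteq> 0"
  shows "h s = h t"
proof -
  let ?g = "\<lambda>s. h s + \<kappa> * s + \<mu>"
  define R' where "R' = max R 0"
  have hg: "?g holomorphic_on UNIV" using hol by (intro holomorphic_intros)
  have hg': "(\<lambda>s. ?g (- s)) holomorphic_on UNIV"
    using holomorphic_on_compose[of uminus UNIV ?g] hg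
    by (simp add: o_def surj_uminus holomorphic_intros)
  obtain C1 where C1: "\<And>s. Re s \<ge> R' + 1 \<Longrightarrow> cmod (?g s) \<le> C1 * (1 + cmod s)\<^sup>2"
    by (rule half_plane_zero_free_Re_growth[of ?g R'])
      (use ne holomorphic_on_subset[OF hg] in \<open>auto simp: R'_def\<close>)
  obtain C2 where C2: "\<And>s. Re s \<ge> R' + 1 \<Longrightarrow> cmod (?g (- s)) \<le> C2 * (1 + cmod s)\<^sup>2"
    by (rule half_plane_zero_free_Re_growth[of "\<lambda>s. ?g (- s)" R'])
      (use ne[of "- _"] holomorphic_on_subset[OF hg'] in \<open>auto simp: R'_def\<close>)
  obtain B where B: "\<And>s. \<bar>Re s\<bar> \<le> R' + 1 \<Longrightarrow> cmod (h s) \<le> B"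
    using strips by blast
  define D where "D = \<bar>C1\<bar> + \<bar>C2\<bar> + \<bar>B\<bar> + cmod \<kappa> + cmod \<mu>"
  have "cmod (h s) \<le> D * (1 + cmod s)\<^sup>2" for s
  proof -
    define q where "q = (1 + cmod s)\<^sup>2"
    have q1: "1 \<le> q" by (simp add: q_def)
    have qs: "cmod s \<le> q" by (simp add: q_def power2_eq_square algebra_simps)
    have lin: "cmod (\<kappa> * s + \<mu>) \<le> cmod \<kappa> * q + cmod \<mu> * q"
    proof -
      have "cmod (\<kappa> * s + \<mu>) \<le> cmod \<kappa> * cmod s + cmod \<mu> * 1"
        by (metis mult.right_neutral norm_mult norm_triangle_ineq)
      also have "\<dots> \<le> cmod \<kappa> * q + cmod \<mu> * q"
        using q1 qs by (intro add_mono mult_left_mono) auto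
      finally show ?thesis .
    qed
    have hle: "cmod (h s) \<le> cmod (?g s) + cmod (\<kappa> * s + \<mu>)"
      using norm_triangle_ineq4[of "?g s" "\<kappa> * s + \<mu>"] by simp
    have nn: "0 \<le> cmod \<kappa> * q" "0 \<le> cmod \<mu> * q" "0 \<le> \<bar>C1\<bar> * q" "0 \<le> \<bar>C2\<bar> * q" "0 \<le> \<bar>B\<bar> * q"
      using q1 by auto
    consider "\<bar>Re s\<bar> \<le> R' + 1" | "Re s \<ge> R' + 1" | "Re (- s) \<ge> R' + 1" by force
    then have "cmod (h s) \<le> \<bar>C1\<bar> * q + \<bar>C2\<bar> * q + \<bar>B\<bar> * q + cmod \<kappa> * q + cmod \<mu> * q"
    proof cases
      case 1
      have "cmod (h s) \<le> \<bar>B\<bar> * 1" using B[OF 1] by simp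
      also have "\<dots> \<le> \<bar>B\<bar> * q" using q1 by (intro mult_left_mono) auto
      finally show ?thesis using nn by linarith
    next
      case 2
      have "C1 * q \<le> \<bar>C1\<bar> * q" using q1 by (intro mult_right_mono) auto
      then show ?thesis using C1[OF 2] hle lin nn unfolding q_def[symmetric] by linarith
    next
      case 3
      have "C2 * q \<le> \<bar>C2\<bar> * q" using q1 by (intro mult_right_mono) auto
      moreover have "cmod (?g s) \<le> C2 * q" using C2[OF 3] by (simp add: q_def)
      ultimately show ?thesis using hle lin nn by linarith
    qed
    then show ?thesis by (simp add: D_def q_def algebra_simps)
  qed
  moreover have "D \<ge> 0" by (simp add: D_def)
  ultimately have quad: "cmod (h s) \<le> (4 * D) * cmod s ^ 2" if "1 \<le> cmod s" for s
  proof -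
    have "(1 + cmod s)\<^sup>2 \<le> (2 * cmod s)\<^sup>2" using that by (intro power_mono) auto
    then have "D * (1 + cmod s)\<^sup>2 \<le> D * (4 * (cmod s)\<^sup>2)"
      using \<open>D \<ge> 0\<close> by (intro mult_left_mono) (auto simp: power_mult_distrib)
    with \<open>cmod (h s) \<le> D * (1 + cmod s)\<^sup>2\<close> show ?thesis by (simp add: mult_ac)
  qed
  let ?c = "\<lambda>k. (deriv ^^ k) h 0 / fact k"
  have poly: "h s = (\<Sum>k\<le>2. ?c k * s ^ k)" for s
    by (rule Liouville_polynomial[OF hol quad])
  obtain B0 where "\<And>s. Re s = 0 \<Longrightarrow> cmod (h s) \<le> B0"
    using strips[of 0] by auto
  then have "h s = ?c 0" for s
    using polynomial_bounded_on_imaginary_axis[of ?c 2 B0 s] by (simp only: poly[symmetric])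
  from this[of s] this[of t] show ?thesis by simp
qed

section \<open>Logarithms of functions on the punctured domain\<close>

text \<open>
  Near \<open>x\<close> the imaginary part of \<open>G s - G x\<close> stays in the range of the principal branch, so \<open>G\<close> differs
  there from \<open>Ln \<circ> (F / F x)\<close> by a constant.
\<close>

lemma continuous_log_has_field_derivative:
  fixes F G :: "complex \<Rightarrow> complex"
  assumes "open S" "x \<in> S" and cont: "continuous_on S G"
    and exp: "\<And>s. s \<in> S \<Longrightarrow> F s = exp (G s)" and F: "(F has_field_derivative D) (at x)"
  shows "(G has_field_derivative D / F x) (at x)"
proof -
  let ?U = "S \<inter> G -` ball (G x) pi"
  have "open ?U"
    using cont \<open>open S\<close> by (rule continuous_open_preimage) simp
  have "x \<in> ?U" using \<open>x \<in> S\<close> by simp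
  have nz: "F x \<noteq> 0" using exp \<open>x \<in> S\<close> by simp
  have quot: "((\<lambda>s. F s / F x) has_field_derivative D / F x) (at x)"
    using F by (rule DERIV_cdivide)
  have "(Ln has_field_derivative inverse (F x / F x)) (at (F x / F x))"
    by (rule has_field_derivative_Ln) (use nz in auto)
  from DERIV_chain2[OF this quot]
  have "((\<lambda>s. G x + Ln (F s / F x)) has_field_derivative D / F x) (at x)"
    using DERIV_add[OF DERIV_const] nz by force
  then show ?thesis
  proof (rule has_field_derivative_transform_within_open[OF _ \<open>open ?U\<close> \<open>x \<in> ?U\<close>])
    fix s assume s: "s \<in> ?U"
    then have "cmod (G s - G x) < pi" by (simp add: dist_norm norm_minus_commute)
    then have "\<bar>Im (G s - G x)\<bar> < pi" using abs_Im_le_cmod[of "G s - G x"] by linarith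
    then have "Ln (exp (G s - G x)) = G s - G x" by (intro Ln_exp) auto
    then show "G x + Ln (F s / F x) = G s" using s exp \<open>x \<in> S\<close> by (simp add: exp_diff)
  qed
qed

lemma continuous_exp_eq_1_imp_constant_integer:
  fixes g :: "'a::topological_space \<Rightarrow> complex"
  assumes T: "connected T" and cont: "continuous_on T g" and exp: "\<And>x. x \<in> T \<Longrightarrow> exp (g x) = 1"
  obtains n :: int where "\<And>x. x \<in> T \<Longrightarrow> g x = 2 * pi * \<i> * of_int n"
proof -
  have int: "\<exists>n :: int. g x = 2 * pi * \<i> * of_int n" if "x \<in> T" for x
    using exp[OF that] unfolding exp_eq_1 by (auto simp: complex_eq_iff)
  have "g constant_on T"
  proof (rule continuous_discrete_range_constant[OF T cont])
    fix x assume x: "x \<in> T"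
    have "2 * pi \<le> cmod (g y - g x)" if y: "y \<in> T" "g y \<noteq> g x" for y
    proof -
      obtain m n :: int where mn: "g x = 2 * pi * \<i> * of_int m" "g y = 2 * pi * \<i> * of_int n"
        using int x y by blast
      then have "m \<noteq> n" using y by auto
      have "g y - g x = 2 * pi * \<i> * of_int (n - m)" by (simp add: mn algebra_simps)
      then have "cmod (g y - g x) = 2 * pi * \<bar>of_int (n - m)\<bar>"
        by (simp add: norm_mult del: of_int_diff)
      moreover have "1 \<le> \<bar>real_of_int (n - m)\<bar>" using \<open>m \<noteq> n\<close> by linarith
      ultimately show ?thesis by (simp del: of_int_diff)
    qed
    then show "\<exists>e>0. \<forall>y. y \<in> T \<and> g y \<noteq> g x \<longrightarrow> e \<le> cmod (g y - g x)"
      by (intro exI[of _ "2 * pi"]) auto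
  qed
  then obtain c where c: "\<And>x. x \<in> T \<Longrightarrow> g x = c" by (auto simp: constant_on_def)
  show thesis
  proof (cases "T = {}")
    case True then show thesis using that by blast
  next
    case False
    then obtain x where "x \<in> T" by blast
    with int c obtain n :: int where "c = 2 * pi * \<i> * of_int n" by metis
    with c that show thesis by blast
  qed
qed

text \<open>
  The universal covering of \<open>D_star \<alpha>\<close> by the left half-plane times the plane. The coordinates are
  chosen so that \<open>Re w\<close> is the logarithm of \<open>|z1| |z2|^\<alpha>\<close>; hence \<open>s \<mapsto> cover \<alpha> w s\<close> runs through
  a whole complex line inside the level set determined by \<open>Re w\<close>. The deck group is generated by the two
  translations of \<open>cover_periods\<close>.
\<close>

definition cover :: "real \<Rightarrow> complex \<Rightarrow> complex \<Rightarrow> complex \<times> complex" where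
  "cover \<alpha> w s = (exp (w - \<alpha> * s), exp s)"

lemma cover_in_D_star_iff: "cover \<alpha> w s \<in> D_star \<alpha> \<longleftrightarrow> Re w < 0"
  by (simp add: cover_def D_star_def powr_def flip: exp_add)

lemma D_star_eq_cover:
  assumes "(z1, z2) \<in> D_star \<alpha>"
  obtains w s where "Re w < 0" "(z1, z2) = cover \<alpha> w s"
proof -
  have nz: "z1 \<noteq> 0" "z2 \<noteq> 0" using assms by (auto simp: D_star_def)
  have eq: "(z1, z2) = cover \<alpha> (Ln z1 + \<alpha> * Ln z2) (Ln z2)"
    using nz by (simp add: cover_def)
  moreover have "Re (Ln z1 + \<alpha> * Ln z2) < 0"
    using assms cover_in_D_star_iff eq by metis
  ultimately show thesis using that by blast
qed

lemma cover_periods: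
  "cover \<alpha> (w + 2 * pi * \<i>) s = cover \<alpha> w s"
  "cover \<alpha> (w + 2 * pi * \<i> * \<alpha>) (s + 2 * pi * \<i>) = cover \<alpha> w s"
  by (auto simp: cover_def exp_eq algebra_simps intro!: exI[of _ 1])

lemma has_field_derivative_along_curve:
  fixes F :: "complex \<times> complex \<Rightarrow> complex"
  assumes F: "(F has_derivative (\<lambda>(u, v). p * u + q * v)) (at (x s, y s))"
    and x: "(x has_field_derivative x') (at s)" and y: "(y has_field_derivative y') (at s)"
  shows "((\<lambda>s. F (x s, y s)) has_field_derivative p * x' + q * y') (at s)"
proof -
  have "((\<lambda>s. (x s, y s)) has_derivative (\<lambda>h. (x' * h, y' * h))) (at s)"
    using x y unfolding has_field_derivative_def by (rule has_derivative_Pair)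
  from has_derivative_compose[OF this F] show ?thesis
    unfolding has_field_derivative_def by (rule has_derivative_eq_rhs) (auto simp: algebra_simps)
qed

lemma cover_derivatives:
  fixes \<alpha> :: real and w s :: complex
  shows
  "((\<lambda>s. exp (w - \<alpha> * s)) has_field_derivative - of_real \<alpha> * exp (w - \<alpha> * s)) (at s)"
  "((\<lambda>w. exp (w - \<alpha> * s)) has_field_derivative exp (w - \<alpha> * s)) (at w)"
  by (auto intro!: derivative_eq_intros)

text \<open>
  A logarithm \<open>G\<close> of \<open>F\<close> on the universal covering, with its increments under the generators of the deck
  group. Holomorphy is required only in each variable separately, since all later arguments restrict
  \<open>G\<close> to a single variable.
\<close>

definition equivariant_log ::
  "real \<Rightarrow> (complex \<times> complex \<Rightarrow> complex) \<Rightarrow> (complex \<Rightarrow> complex \<Rightarrow> complex) \<Rightarrow> int \<Rightarrow> int \<Rightarrow> bool" where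
  "equivariant_log \<alpha> F G k1 k2 \<longleftrightarrow>
    continuous_on ({w. Re w < 0} \<times> UNIV) (\<lambda>(w, s). G w s) \<and>
    (\<forall>w s. Re w < 0 \<longrightarrow> F (cover \<alpha> w s) = exp (G w s)) \<and>
    (\<forall>w. Re w < 0 \<longrightarrow> G w holomorphic_on UNIV) \<and>
    (\<forall>s. (\<lambda>w. G w s) holomorphic_on {w. Re w < 0}) \<and>
    (\<forall>w s. Re w < 0 \<longrightarrow> G (w + 2 * pi * \<i>) s = G w s + 2 * pi * \<i> * of_int k1) \<and>
    (\<forall>w s. Re w < 0 \<longrightarrow>
       G (w + 2 * pi * \<i> * \<alpha>) (s + 2 * pi * \<i>) = G w s + 2 * pi * \<i> * of_int k2)"

lemma equivariant_logD:
  assumes "equivariant_log \<alpha> F G k1 k2"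
  shows "continuous_on ({w. Re w < 0} \<times> UNIV) (\<lambda>(w, s). G w s)"
    and "Re w < 0 \<Longrightarrow> F (cover \<alpha> w s) = exp (G w s)"
    and "Re w < 0 \<Longrightarrow> G w holomorphic_on UNIV"
    and "(\<lambda>w. G w s) holomorphic_on {w. Re w < 0}"
    and "Re w < 0 \<Longrightarrow> G (w + 2 * pi * \<i>) s = G w s + 2 * pi * \<i> * of_int k1"
    and "Re w < 0 \<Longrightarrow>
           G (w + 2 * pi * \<i> * \<alpha>) (s + 2 * pi * \<i>) = G w s + 2 * pi * \<i> * of_int k2"
  using assms unfolding equivariant_log_def by auto

text \<open>
  The total space of the covering is convex, so a continuous logarithm exists, and it inherits
  holomorphy from \<open>F\<close>. Its increment under a deck transformation has exponential \<open>1\<close>, so it takes values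
  in the discrete set \<open>2\<pi>\<i>\<int>\<close> and is constant by connectedness.
\<close>

lemma logarithm_lift:
  fixes F :: "complex \<times> complex \<Rightarrow> complex" and \<alpha> :: real
  assumes diff: "\<And>z. z \<in> D_star \<alpha> \<Longrightarrow> \<exists>p q. (F has_derivative (\<lambda>(u, v). p * u + q * v)) (at z)"
    and nz: "\<And>z. z \<in> D_star \<alpha> \<Longrightarrow> F z \<noteq> 0"
  obtains G k1 k2 where "equivariant_log \<alpha> F G k1 k2"
proof -
  let ?T = "{w :: complex. Re w < 0} \<times> (UNIV :: complex set)"
  have convT: "convex ?T" by (intro convex_Times convex_left_half_plane convex_UNIV)
  have contF: "continuous_on (D_star \<alpha>) F"
    using diff has_derivative_continuous by (metis continuous_at_imp_continuous_on)
  have cont_cover: "continuous_on ?T (\<lambda>(w, s). cover \<alpha> w s)"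
    unfolding cover_def case_prod_beta by (intro continuous_intros)
  have "continuous_on ?T (\<lambda>x. F ((\<lambda>(w, s). cover \<alpha> w s) x))"
    by (rule continuous_on_compose2[OF contF cont_cover]) (auto simp: cover_in_D_star_iff)
  moreover have "F ((\<lambda>(w, s). cover \<alpha> w s) x) \<noteq> 0" if "x \<in> ?T" for x
    using nz[of "cover \<alpha> (fst x) (snd x)"] that by (auto simp: cover_in_D_star_iff)
  ultimately obtain g where contg: "continuous_on ?T g"
    and g: "\<And>x. x \<in> ?T \<Longrightarrow> F ((\<lambda>(w, s). cover \<alpha> w s) x) = exp (g x)"
    using continuous_logarithm_on_contractible[OF _ convex_imp_contractible[OF convT]] by metis
  define G where "G = (\<lambda>w s. g (w, s))"
  have G_exp: "F (cover \<alpha> w s) = exp (G w s)" if "Re w < 0" for w s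
    using g[of "(w, s)"] that by (simp add: G_def)
  have contG: "continuous_on ?T (\<lambda>(w, s). G w s)"
    using contg by (simp add: G_def)
  have 1: "G w holomorphic_on UNIV" if w: "Re w < 0" for w
  proof -
    have cont: "continuous_on UNIV (G w)"
      unfolding G_def by (rule continuous_on_compose2[OF contg]) (use w in \<open>auto intro!: continuous_intros\<close>)
    have "\<exists>D. (G w has_field_derivative D) (at s)" for s
    proof -
      obtain p q where F: "(F has_derivative (\<lambda>(u, v). p * u + q * v)) (at (exp (w - \<alpha> * s), exp s))"
        using diff[of "cover \<alpha> w s"] w by (auto simp: cover_in_D_star_iff) (auto simp: cover_def)
      have "((\<lambda>s. F (cover \<alpha> w s)) has_field_derivative
          p * (- of_real \<alpha> * exp (w - \<alpha> * s)) + q * exp s) (at s)"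
        unfolding cover_def
        by (rule has_field_derivative_along_curve[OF F cover_derivatives(1) DERIV_exp])
      then show ?thesis
        using continuous_log_has_field_derivative[OF open_UNIV _ cont G_exp[OF w]] by blast
    qed
    then show ?thesis by (auto simp: holomorphic_on_def field_differentiable_def)
  qed
  have 2: "(\<lambda>w. G w s) holomorphic_on {w. Re w < 0}" for s
  proof -
    have cont: "continuous_on {w. Re w < 0} (\<lambda>w. G w s)"
      unfolding G_def by (rule continuous_on_compose2[OF contg]) (auto intro!: continuous_intros)
    have "\<exists>D. ((\<lambda>w. G w s) has_field_derivative D) (at w)" if w: "Re w < 0" for w
    proof -
      obtain p q where F: "(F has_derivative (\<lambda>(u, v). p * u + q * v)) (at (exp (w - \<alpha> * s), exp s))"
        using diff[of "cover \<alpha> w s"] w by (auto simp: cover_in_D_star_iff) (auto simp: cover_def)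
      have "((\<lambda>w. F (cover \<alpha> w s)) has_field_derivative
          p * exp (w - \<alpha> * s) + q * 0) (at w)"
        unfolding cover_def
        by (rule has_field_derivative_along_curve[OF F cover_derivatives(2) DERIV_const])
      then show ?thesis
        using continuous_log_has_field_derivative[OF open_left_half_plane _ cont G_exp] w by blast
    qed
    then show ?thesis
      unfolding holomorphic_on_def field_differentiable_def
      using has_field_derivative_at_within by blast
  qed
  have per: "\<exists>n :: int. \<forall>w s. Re w < 0 \<longrightarrow> G (w + p) (s + q) = G w s + 2 * pi * \<i> * of_int n"
    if p: "Re p = 0" "\<And>w s. cover \<alpha> (w + p) (s + q) = cover \<alpha> w s" for p q
  proof -
    have shift: "continuous_on ?T (\<lambda>x. g (fst x + p, snd x + q))"
      by (rule continuous_on_compose2[OF contg]) (use p in \<open>auto intro!: continuous_intros\<close>)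
    obtain n :: int where n: "\<And>x. x \<in> ?T \<Longrightarrow> g (fst x + p, snd x + q) - g x = 2 * pi * \<i> * of_int n"
    proof (rule continuous_exp_eq_1_imp_constant_integer[of ?T "\<lambda>x. g (fst x + p, snd x + q) - g x"])
      show "connected ?T" using convT by (rule convex_connected)
      show "continuous_on ?T (\<lambda>x. g (fst x + p, snd x + q) - g x)"
        using shift contg by (rule continuous_on_diff)
      show "exp (g (fst x + p, snd x + q) - g x) = 1" if "x \<in> ?T" for x
        using that G_exp[of "fst x" "snd x"] G_exp[of "fst x + p" "snd x + q"] p
        by (auto simp: G_def exp_diff)
    qed blast
    have "G (w + p) (s + q) = G w s + 2 * pi * \<i> * of_int n" if "Re w < 0" for w s
      using n[of "(w, s)"] that by (simp add: G_def algebra_simps)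
    then show ?thesis by blast
  qed
  obtain k1 :: int where k1: "\<And>w s. Re w < 0 \<Longrightarrow> G (w + 2 * pi * \<i>) (s + 0) = G w s + 2 * pi * \<i> * of_int k1"
    using per[of "2 * pi * \<i>" 0] cover_periods(1) by auto
  obtain k2 :: int where k2: "\<And>w s. Re w < 0 \<Longrightarrow>
      G (w + 2 * pi * \<i> * \<alpha>) (s + 2 * pi * \<i>) = G w s + 2 * pi * \<i> * of_int k2"
    using per[of "2 * pi * \<i> * \<alpha>" "2 * pi * \<i>"] cover_periods(2) by auto
  have "equivariant_log \<alpha> F G k1 k2"
    unfolding equivariant_log_def using contG G_exp 1 2 k1 k2 by simp
  then show thesis by (rule that)
qed

text \<open>
  The deck group acts cocompactly on the set of points with prescribed \<open>Re w\<close> and bounded \<open>Re s\<close>, which is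
  the preimage of a compact piece of \<open>D_star \<alpha>\<close>: first \<open>Im s\<close>, then \<open>Im w\<close> can be moved into
  \<open>[0, 2\<pi>]\<close>.
\<close>

lemma doubly_periodic_bounded_on_strips:
  fixes h :: "complex \<Rightarrow> complex \<Rightarrow> complex" and \<alpha> :: real
  assumes cont: "continuous_on ({w. Re w < 0} \<times> UNIV) (\<lambda>(w, s). h w s)"
    and p1: "\<And>w s. Re w < 0 \<Longrightarrow> h (w + 2 * pi * \<i>) s = h w s"
    and p2: "\<And>w s. Re w < 0 \<Longrightarrow> h (w + 2 * pi * \<i> * \<alpha>) (s + 2 * pi * \<i>) = h w s"
    and w: "Re w < 0"
  shows "\<exists>B. \<forall>s. \<bar>Re s\<bar> \<le> M \<longrightarrow> cmod (h w s) \<le> B"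
proof -
  let ?T = "{w :: complex. Re w < 0} \<times> (UNIV :: complex set)"
  let ?h = "\<lambda>(w, s). h w s"
  define Q where "Q = cbox (Complex (Re w) 0) (Complex (Re w) (2 * pi)) \<times>
                      cbox (Complex (- M) 0) (Complex M (2 * pi))"
  have "Q \<subseteq> ?T" using w by (auto simp: Q_def in_cbox_complex_iff)
  then have "continuous_on Q ?h" using cont continuous_on_subset by blast
  moreover have "compact Q" unfolding Q_def by (intro compact_Times compact_cbox)
  ultimately have "bounded (?h ` Q)"
    using compact_continuous_image compact_imp_bounded by blast
  then obtain B where B: "\<And>x. x \<in> Q \<Longrightarrow> cmod (?h x) \<le> B"
    unfolding bounded_iff by blast
  have mod: "0 \<le> x - of_int \<lfloor>x / (2 * pi)\<rfloor> * (2 * pi)" "x - of_int \<lfloor>x / (2 * pi)\<rfloor> * (2 * pi) \<le> 2 * pi" for x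
  proof -
    have "x - of_int \<lfloor>x / (2 * pi)\<rfloor> * (2 * pi) = 2 * pi * frac (x / (2 * pi))"
      by (simp add: frac_def algebra_simps)
    then show "0 \<le> x - of_int \<lfloor>x / (2 * pi)\<rfloor> * (2 * pi)" "x - of_int \<lfloor>x / (2 * pi)\<rfloor> * (2 * pi) \<le> 2 * pi"
      using frac_ge_0[of "x / (2 * pi)"] frac_lt_1[of "x / (2 * pi)"] by (simp_all add: mult_le_cancel_left1)
  qed
  have "cmod (h w s) \<le> B" if s: "\<bar>Re s\<bar> \<le> M" for s
  proof -
    define n where "n = - \<lfloor>Im s / (2 * pi)\<rfloor>"
    define x where "x = (w, s) + of_int n *\<^sub>R (2 * pi * \<i> * \<alpha>, 2 * pi * \<i>)"
    define m where "m = - \<lfloor>Im (fst x) / (2 * pi)\<rfloor>"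
    define y where "y = x + of_int m *\<^sub>R (2 * pi * \<i>, 0)"
    have x: "x \<in> ?T" "?h x = ?h (w, s)"
      unfolding x_def
      using iterate_period[of "(2 * pi * \<i> * \<alpha>, 2 * pi * \<i>)" ?T ?h "(w, s)" n] p2 w by auto
    have y: "?h y = ?h x"
      unfolding y_def
      using iterate_period(2)[of "(2 * pi * \<i>, 0)" ?T ?h x m] p1 x by auto
    have "y \<in> Q"
      using s mod[of "Im s"] mod[of "Im (fst x)"]
      by (auto simp: Q_def y_def x_def in_cbox_complex_iff m_def n_def)
    with B[of y] x y show ?thesis by simp
  qed
  then show ?thesis by blast
qed

section \<open>Proper maps are monomial\<close>

lemma D_star_iff_ln:
  "(z1, z2) \<in> D_star \<gamma> \<longleftrightarrow> z1 \<noteq> 0 \<and> z2 \<noteq> 0 \<and> ln (cmod z1) + \<gamma> * ln (cmod z2) < 0"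
proof (cases "z1 = 0 \<or> z2 = 0")
  case False
  then have "cmod z1 * cmod z2 powr \<gamma> = exp (ln (cmod z1) + \<gamma> * ln (cmod z2))"
    by (simp add: powr_def exp_add)
  with False show ?thesis by (simp add: D_star_def)
qed (auto simp: D_star_def)

lemma ln_power_int:
  fixes x :: real
  assumes "x > 0"
  shows "ln (x powi n) = of_int n * ln x"
proof -
  have "x powi n = exp (of_int n * ln x)" using assms by (metis exp_ln exp_power_int)
  then show ?thesis by simp
qed

lemma holomorphic_map_on_components:
  assumes "holomorphic_map_on f U" "z \<in> U"
  shows "\<exists>p q. ((\<lambda>z. fst (f z)) has_derivative (\<lambda>(u, v). p * u + q * v)) (at z)"
    and "\<exists>p q. ((\<lambda>z. snd (f z)) has_derivative (\<lambda>(u, v). p * u + q * v)) (at z)"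
proof -
  obtain p q r s where f: "(f has_derivative (\<lambda>(u, v). (p * u + q * v, r * u + s * v))) (at z)"
    using assms unfolding holomorphic_map_on_def by blast
  have "((\<lambda>z. fst (f z)) has_derivative (\<lambda>(u, v). p * u + q * v)) (at z)"
    by (rule has_derivative_eq_rhs[OF has_derivative_fst[OF f]]) auto
  then show "\<exists>p q. ((\<lambda>z. fst (f z)) has_derivative (\<lambda>(u, v). p * u + q * v)) (at z)" by blast
  have "((\<lambda>z. snd (f z)) has_derivative (\<lambda>(u, v). r * u + s * v)) (at z)"
    by (rule has_derivative_eq_rhs[OF has_derivative_snd[OF f]]) auto
  then show "\<exists>p q. ((\<lambda>z. snd (f z)) has_derivative (\<lambda>(u, v). p * u + q * v)) (at z)" by blast
qed

text \<open>
  Let \<open>G1\<close>, \<open>G2\<close> be logarithms of the components of \<open>f\<close>. The function \<open>U = G1 + \<beta> G2\<close> has negative real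
  part, so it is constant along each leaf \<open>w = const\<close> and, by its quasi-periods, affine in \<open>w\<close>. This
  yields the relation between the exponents and determines \<open>G1\<close> from \<open>G2\<close>. It remains to see that
  \<open>G2\<close> is affine, that is, that the deck-invariant function \<open>h\<close> below is constant; this uses properness.
\<close>

lemma proper_holomorphic_imp_monomial:
  fixes \<alpha> \<beta> :: real
  assumes \<alpha>: "\<alpha> \<notin> \<rat>" and proper: "proper_holomorphic (D_star \<alpha>) (D_star \<beta>) f"
  obtains k1 k2 l1 l2 :: int and a b :: complex where
    "a \<noteq> 0" "b \<noteq> 0" "\<alpha> * (k1 + \<beta> * l1) = k2 + \<beta> * l2"
    "\<And>z1 z2. (z1, z2) \<in> D_star \<alpha> \<Longrightarrow>
       f (z1, z2) = (a * z1 powi k1 * z2 powi k2, b * z1 powi l1 * z2 powi l2)"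
proof -
  have hol: "holomorphic_map_on f (D_star \<alpha>)" and maps: "\<And>z. z \<in> D_star \<alpha> \<Longrightarrow> f z \<in> D_star \<beta>"
    and cpt: "\<And>K. K \<subseteq> D_star \<beta> \<Longrightarrow> compact K \<Longrightarrow> compact {z \<in> D_star \<alpha>. f z \<in> K}"
    using proper by (auto simp: proper_holomorphic_iff_compact_preimages)
  have nz: "fst (f z) \<noteq> 0" "snd (f z) \<noteq> 0" if "z \<in> D_star \<alpha>" for z
    using maps[OF that] D_star_iff_ln[of "fst (f z)" "snd (f z)"] by auto
  obtain G1 k1 k2 where "equivariant_log \<alpha> (\<lambda>z. fst (f z)) G1 k1 k2"
    using logarithm_lift[of \<alpha> "\<lambda>z. fst (f z)"] holomorphic_map_on_components(1)[OF hol] nz(1) by blast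
  note G1 = equivariant_logD[OF this]
  obtain G2 l1 l2 where "equivariant_log \<alpha> (\<lambda>z. snd (f z)) G2 l1 l2"
    using logarithm_lift[of \<alpha> "\<lambda>z. snd (f z)"] holomorphic_map_on_components(2)[OF hol] nz(2) by blast
  note G2 = equivariant_logD[OF this]
  have f_cover: "f (cover \<alpha> w s) = (exp (G1 w s), exp (G2 w s))" if "Re w < 0" for w s
    using G1(2)[OF that] G2(2)[OF that] by (simp add: prod_eq_iff)

  define U where "U = (\<lambda>w s. G1 w s + \<beta> * G2 w s)"
  have U_neg: "Re (U w s) < 0" if "Re w < 0" for w s
    using maps[of "cover \<alpha> w s"] that
    by (simp add: f_cover cover_in_D_star_iff D_star_iff_ln U_def)
  have U_leaf: "U w s = U w 0" if w: "Re w < 0" for w s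
  proof (rule entire_Re_negative_imp_constant[of "U w"])
    show "U w holomorphic_on UNIV"
      unfolding U_def using G1(3)[OF w] G2(3)[OF w] by (intro holomorphic_intros)
  qed (use U_neg w in auto)
  have U_hol: "(\<lambda>w. U w 0) holomorphic_on {w. Re w < 0}"
    unfolding U_def using G1(4) G2(4) by (intro holomorphic_intros)
  have U_p1: "U (w + 2 * pi * \<i>) 0 = U w 0 + 2 * pi * \<i> * of_real (k1 + \<beta> * l1)" if "Re w < 0" for w
    unfolding U_def G1(5)[OF that] G2(5)[OF that] by (simp add: algebra_simps)
  have U_p2: "U (w + 2 * pi * \<i> * \<alpha>) 0 = U w 0 + 2 * pi * \<i> * of_real (k2 + \<beta> * l2)"
    if w: "Re w < 0" for w
  proof -
    have "U (w + 2 * pi * \<i> * \<alpha>) 0 = U (w + 2 * pi * \<i> * \<alpha>) (0 + 2 * pi * \<i>)"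
      using U_leaf[of "w + 2 * pi * \<i> * \<alpha>" "0 + 2 * pi * \<i>"] w by simp
    also have "\<dots> = U w 0 + 2 * pi * \<i> * of_real (k2 + \<beta> * l2)"
      unfolding U_def G1(6)[OF w] G2(6)[OF w] by (simp add: algebra_simps)
    finally show ?thesis .
  qed
  obtain c d where U_aff: "\<And>w. Re w < 0 \<Longrightarrow> U w 0 = c * w + d"
    and c: "2 * pi * \<i> * of_real (k1 + \<beta> * l1) = 2 * pi * \<i> * c"
    and \<alpha>c: "2 * pi * \<i> * of_real (k2 + \<beta> * l2) = \<alpha> * (2 * pi * \<i> * of_real (k1 + \<beta> * l1))"
    using two_quasi_periods_imp_affine[OF \<alpha> U_hol U_p1 U_p2] by metis
  have c_eq: "c = of_real (k1 + \<beta> * l1)" using c by simp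
  have "complex_of_real (\<alpha> * (k1 + \<beta> * l1)) = of_real (k2 + \<beta> * l2)"
    using \<alpha>c by (simp add: mult_ac del: of_real_add)
  then have exps: "\<alpha> * (k1 + \<beta> * l1) = k2 + \<beta> * l2" by (simp only: of_real_eq_iff)

  define h where "h = (\<lambda>w s :: complex. G2 w s - of_int l1 * (w - \<alpha> * s) - of_int l2 * s)"
  have h_cont: "continuous_on ({w. Re w < 0} \<times> UNIV) (\<lambda>(w, s). h w s)"
    using G2(1) unfolding h_def case_prod_beta by (intro continuous_intros)
  have h_p1: "h (w + 2 * pi * \<i>) s = h w s" if "Re w < 0" for w s
    using G2(5)[OF that, of s] by (simp add: h_def algebra_simps)
  have h_p2: "h (w + 2 * pi * \<i> * \<alpha>) (s + 2 * pi * \<i>) = h w s" if "Re w < 0" for w s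
    using G2(6)[OF that, of s] by (simp add: h_def algebra_simps)
  have h_leaf: "h w s = h w 0" if w: "Re w < 0" for w s
  proof -
    \<comment> \<open>The image of the leaf lies in the level set \<open>|z1| |z2|^\<beta> = \<rho>\<close>, whose part over \<open>|z2| = 1\<close> is the
      torus \<open>K\<close>. By properness the leaf meets the preimage of \<open>K\<close> only where \<open>Re s\<close> is bounded, so
      \<open>Re G2\<close> has no zeros for large \<open>|Re s|\<close>.\<close>
    define \<rho> where "\<rho> = exp (Re (U w 0))"
    define K where "K = sphere (0 :: complex) \<rho> \<times> sphere (0 :: complex) 1"
    define P where "P = {z \<in> D_star \<alpha>. f z \<in> K}"
    have "K \<subseteq> D_star \<beta>"
      using U_neg[OF w, of 0] by (auto simp: K_def \<rho>_def D_star_def)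
    moreover have "compact K" unfolding K_def by (intro compact_Times compact_sphere)
    ultimately have "compact P" unfolding P_def by (rule cpt)
    moreover have "continuous_on P (\<lambda>z. ln (cmod (snd z)))"
      by (intro continuous_intros) (auto simp: P_def D_star_iff_ln)
    ultimately have "bounded ((\<lambda>z. ln (cmod (snd z))) ` P)"
      by (intro compact_imp_bounded compact_continuous_image)
    then obtain R where R: "\<And>z. z \<in> P \<Longrightarrow> \<bar>ln (cmod (snd z))\<bar> \<le> R"
      by (auto simp: bounded_iff)
    have "Re (G2 w s) \<noteq> 0" if s: "\<bar>Re s\<bar> > R" for s
    proof
      assume 0: "Re (G2 w s) = 0"
      have "Re (G1 w s) = Re (U w s)" by (simp add: U_def 0)
      also have "\<dots> = Re (U w 0)" using U_leaf[OF w, of s] by simp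
      finally have "cover \<alpha> w s \<in> P"
        using w 0 by (simp add: P_def K_def \<rho>_def f_cover cover_in_D_star_iff)
      then show False using R[of "cover \<alpha> w s"] s by (simp add: cover_def)
    qed
    moreover define \<kappa> :: complex where "\<kappa> = of_int l2 - of_int l1 * \<alpha>"
    have "G2 w s = h w s + \<kappa> * s + of_int l1 * w" for s
      by (simp add: h_def \<kappa>_def algebra_simps)
    ultimately have ne: "Re (h w s + \<kappa> * s + of_int l1 * w) \<noteq> 0" if "\<bar>Re s\<bar> > R" for s
      using that by metis
    have strips: "\<exists>B. \<forall>s. \<bar>Re s\<bar> \<le> M \<longrightarrow> cmod (h w s) \<le> B" for M
      by (rule doubly_periodic_bounded_on_strips[where \<alpha> = \<alpha>]) (fact h_cont h_p1 h_p2 w)+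
    have "h w holomorphic_on UNIV"
      unfolding h_def using G2(3)[OF w] by (intro holomorphic_intros)
    then show ?thesis
      using strips ne by (rule entire_bounded_on_strips_imp_constant)
  qed
  have "(\<lambda>w. h w 0) constant_on {w. Re w < 0}"
  proof (rule two_periods_imp_constant[OF \<alpha>])
    show "(\<lambda>w. h w 0) holomorphic_on {w. Re w < 0}"
      unfolding h_def using G2(4)[of 0] by (intro holomorphic_intros)
    fix w :: complex assume w: "Re w < 0"
    then show "h (w + 2 * pi * \<i>) 0 = h w 0" by (rule h_p1)
    show "h (w + 2 * pi * \<i> * \<alpha>) 0 = h w 0"
      using h_p2[OF w, of 0] h_leaf[of "w + 2 * pi * \<i> * \<alpha>" "0 + 2 * pi * \<i>"] w by simp
  qed
  then obtain B where "\<And>w. Re w < 0 \<Longrightarrow> h w 0 = B"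
    by (auto simp: constant_on_def)
  then have h_const: "h w s = B" if "Re w < 0" for w s using h_leaf that by metis

  have G2_eq: "G2 w s = B + of_int l1 * (w - \<alpha> * s) + of_int l2 * s" if "Re w < 0" for w s :: complex
    using h_const[OF that, of s] by (simp add: h_def algebra_simps)
  have G1_eq: "G1 w s = (d - \<beta> * B) + of_int k1 * (w - \<alpha> * s) + of_int k2 * s"
    if w: "Re w < 0" for w s :: complex
  proof -
    have k2: "(of_int k2 :: complex) = \<alpha> * (of_int k1 + \<beta> * of_int l1) - \<beta> * of_int l2"
      using arg_cong[OF exps, of complex_of_real] by (simp add: algebra_simps)
    have "G1 w s = U w s - \<beta> * G2 w s" by (simp add: U_def)
    also have "\<dots> = c * w + d - \<beta> * G2 w s" using U_leaf[OF w, of s] U_aff[OF w] by simp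
    finally show ?thesis unfolding G2_eq[OF w] c_eq k2 by (simp add: algebra_simps)
  qed
  have "f (z1, z2) = (exp (d - \<beta> * B) * z1 powi k1 * z2 powi k2, exp B * z1 powi l1 * z2 powi l2)"
    if "(z1, z2) \<in> D_star \<alpha>" for z1 z2
  proof -
    from that obtain w s where w: "Re w < 0" and z: "(z1, z2) = cover \<alpha> w s"
      by (rule D_star_eq_cover)
    have "z1 = exp (w - \<alpha> * s)" "z2 = exp s" using z by (simp_all add: cover_def)
    then show ?thesis
      unfolding z f_cover[OF w] by (simp add: G1_eq[OF w] G2_eq[OF w] exp_power_int exp_add)
  qed
  from that[OF exp_not_eq_zero exp_not_eq_zero exps this] show thesis .
qed

text \<open>
  Follow \<open>f\<close> along the points \<open>(t, 1)\<close> with \<open>0 < t < 1\<close>, which leave the domain as \<open>t \<rightarrow> 1\<close>. There the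
  logarithm of the defining function of the target is \<open>N + c ln t\<close>, with \<open>c = k1 + \<beta> l1\<close>. It is negative
  because \<open>f\<close> maps into the target, and if \<open>N\<close> were negative, the images would converge to a point of the
  target, against properness.
\<close>

lemma proper_monomial_normalization:
  fixes \<alpha> \<beta> :: real and k1 k2 l1 l2 :: int
  assumes proper: "proper_holomorphic (D_star \<alpha>) (D_star \<beta>) f"
    and ab: "a \<noteq> 0" "b \<noteq> 0"
    and f: "\<And>z1 z2. (z1, z2) \<in> D_star \<alpha> \<Longrightarrow>
              f (z1, z2) = (a * z1 powi k1 * z2 powi k2, b * z1 powi l1 * z2 powi l2)"
  shows "k1 + \<beta> * l1 > 0" "cmod a * cmod b powr \<beta> = 1"
proof -
  define c where "c = k1 + \<beta> * l1"
  define N where "N = ln (cmod a) + \<beta> * ln (cmod b)"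
  define \<gamma> where "\<gamma> = (\<lambda>t::real. (a * of_real t powi k1, b * of_real t powi l1))"
  have maps: "\<And>z. z \<in> D_star \<alpha> \<Longrightarrow> f z \<in> D_star \<beta>"
    and cpt: "\<And>K. K \<subseteq> D_star \<beta> \<Longrightarrow> compact K \<Longrightarrow> compact {z \<in> D_star \<alpha>. f z \<in> K}"
    using proper by (auto simp: proper_holomorphic_iff_compact_preimages)
  have \<gamma>_in: "\<gamma> t \<in> D_star \<beta> \<longleftrightarrow> N + c * ln t < 0" if "t > 0" for t
    using that ab
    by (simp add: \<gamma>_def D_star_iff_ln norm_mult norm_power_int ln_mult ln_power_int N_def c_def algebra_simps)
  have seg: "(of_real t, 1) \<in> D_star \<alpha>" if "0 < t" "t < 1" for t :: real
    using that by (simp add: D_star_iff_ln)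
  have f_seg: "f (of_real t, 1) = \<gamma> t" if "0 < t" "t < 1" for t :: real
    using f[OF seg[OF that]] by (simp add: \<gamma>_def)
  have neg: "N + c * ln t < 0" if "0 < t" "t < 1" for t
    using maps[OF seg[OF that]] f_seg[OF that] \<gamma>_in that by simp
  have "N \<ge> 0"
  proof (rule ccontr)
    assume "\<not> N \<ge> 0"
    then have "\<gamma> t \<in> D_star \<beta>" if "t \<in> {1/2..1}" for t
      using that neg[of t] \<gamma>_in[of t] by (cases "t = 1") auto
    moreover have "compact (\<gamma> ` {1/2..1})"
      unfolding \<gamma>_def by (intro compact_continuous_image continuous_intros) auto
    ultimately have "compact {z \<in> D_star \<alpha>. f z \<in> \<gamma> ` {1/2..1}}" (is "compact ?P")
      by (intro cpt) auto
    then have "closed ?P" by (rule compact_imp_closed)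
    let ?t = "\<lambda>n. 1 - 1 / real (n + 2)"
    have "(complex_of_real (?t n), 1) \<in> ?P" for n
    proof -
      have "1 / real (n + 2) \<le> 1 / 2" "1 / real (n + 2) > 0" by (auto simp: field_simps)
      then have t: "?t n \<in> {1/2..1}" "0 < ?t n" "?t n < 1" by auto
      then show ?thesis using seg[OF t(2,3)] f_seg[OF t(2,3)] by blast
    qed
    moreover have "?t \<longlonglongrightarrow> 1" by real_asymp
    then have "(\<lambda>n. (complex_of_real (?t n), 1 :: complex)) \<longlonglongrightarrow> (of_real 1, 1)"
      by (intro tendsto_intros)
    ultimately have "(of_real 1, 1) \<in> ?P"
      using \<open>closed ?P\<close> by (meson closed_sequentially)
    then show False by (simp add: D_star_iff_ln)
  qed
  then have "c * ln (1/2) < 0" using neg[of "1/2"] by simp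
  then show c: "k1 + \<beta> * l1 > 0"
    unfolding c_def[symmetric] by (simp add: ln_div zero_less_mult_iff)
  have "N \<le> 0"
  proof (rule ccontr)
    assume "\<not> N \<le> 0"
    \<comment> \<open>the parameter \<open>t = exp (- N / c)\<close> is the zero of \<open>N + c ln t\<close>\<close>
    then have "exp (- N / c) < 1" using c by (simp add: c_def)
    from neg[OF _ this] show False using c by (simp add: c_def)
  qed
  with \<open>N \<ge> 0\<close> have "N = 0" by simp
  then have "exp (ln (cmod a) + \<beta> * ln (cmod b)) = 1" by (simp add: N_def)
  then show "cmod a * cmod b powr \<beta> = 1"
    using ab by (simp add: exp_add powr_def)
qed

section \<open>Monomial maps are proper\<close>

text \<open>
  On logarithms of moduli the map is linear with determinant \<open>\<Delta> = k1 l2 - k2 l1\<close>, and it multiplies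
  \<open>ln |z1| + \<alpha> ln |z2|\<close> by the positive factor \<open>k1 + \<beta> l1\<close>. If \<open>\<Delta>\<close> vanished, \<open>\<alpha>\<close> would be a ratio of
  integers. So the linear map is invertible, and bounds on the logarithms of the moduli of the image,
  valid on a compact set \<open>K\<close>, give bounds on those of \<open>z\<close>: the preimage of \<open>K\<close> is a closed subset of a
  product \<open>A \<times> A\<close> of closed annuli around \<open>0\<close>.
\<close>

lemma proper_holomorphic_monomial:
  fixes \<alpha> \<beta> :: real and k1 k2 l1 l2 :: int
  assumes \<alpha>: "\<alpha> \<notin> \<rat>" and c: "k1 + \<beta> * l1 > 0" and \<alpha>c: "\<alpha> * (k1 + \<beta> * l1) = k2 + \<beta> * l2"
  shows "proper_holomorphic (D_star \<alpha>) (D_star \<beta>)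
           (\<lambda>z. (fst z powi k1 * snd z powi k2, fst z powi l1 * snd z powi l2))"
    (is "proper_holomorphic _ _ ?f")
proof -
  define \<Delta> where "\<Delta> = real_of_int (k1 * l2 - k2 * l1)"
  have "\<Delta> \<noteq> 0"
  proof
    assume "\<Delta> = 0"
    then have det: "real_of_int k1 * l2 = real_of_int k2 * l1"
      by (simp add: \<Delta>_def flip: of_int_mult)
    have "(k1 + \<beta> * l1) * (\<alpha> * k1) = (k1 + \<beta> * l1) * k2"
      using \<alpha>c det by algebra
    then have 1: "\<alpha> * k1 = k2" using c by simp
    have "(k1 + \<beta> * l1) * (\<alpha> * l1) = (k1 + \<beta> * l1) * l2"
      using \<alpha>c det by algebra
    then have 2: "\<alpha> * l1 = l2" using c by simp
    have "k1 \<noteq> 0 \<or> l1 \<noteq> 0" using c by auto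
    then have "\<alpha> = of_int k2 / of_int k1 \<or> \<alpha> = of_int l2 / of_int l1"
      using 1 2 by (auto simp: field_simps)
    with \<alpha> show False by auto
  qed
  have ln_f: "ln (cmod (z1 powi k * z2 powi l)) = k * ln (cmod z1) + l * ln (cmod z2)"
    if "z1 \<noteq> 0" "z2 \<noteq> 0" for z1 z2 and k l :: int
    using that by (simp add: norm_mult norm_power_int ln_mult ln_power_int)
  have in_iff: "?f (z1, z2) \<in> D_star \<beta> \<longleftrightarrow> (z1, z2) \<in> D_star \<alpha>" if nz: "z1 \<noteq> 0" "z2 \<noteq> 0" for z1 z2
  proof -
    let ?x = "ln (cmod z1)" and ?y = "ln (cmod z2)"
    have "(k1 * ?x + k2 * ?y) + \<beta> * (l1 * ?x + l2 * ?y) = (k1 + \<beta> * l1) * ?x + (k2 + \<beta> * l2) * ?y"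
      by (simp add: algebra_simps)
    also have "\<dots> = (k1 + \<beta> * l1) * (?x + \<alpha> * ?y)"
      unfolding \<alpha>c[symmetric] by (simp add: algebra_simps)
    finally show ?thesis
      using c nz by (simp add: D_star_iff_ln ln_f mult_less_0_iff)
  qed
  have hol: "holomorphic_map_on ?f (D_star \<alpha>)"
    unfolding holomorphic_map_on_def
  proof
    fix z assume "z \<in> D_star \<alpha>"
    then have nz: "fst z \<noteq> 0" "snd z \<noteq> 0" by (cases z; simp add: D_star_iff_ln)+
    have mono: "((\<lambda>z. fst z powi k * snd z powi l) has_derivative
        (\<lambda>(u, v). (of_int k * fst z powi (k - 1) * snd z powi l) * u +
                  (of_int l * fst z powi k * snd z powi (l - 1)) * v)) (at z)" for k l :: int
      by (rule has_derivative_eq_rhs, (rule derivative_intros nz)+) (auto simp: algebra_simps)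
    show "\<exists>p q r s. (?f has_derivative (\<lambda>(u, v). (p * u + q * v, r * u + s * v))) (at z)"
      by (intro exI, rule has_derivative_eq_rhs[OF has_derivative_Pair[OF mono mono]]) auto
  qed
  have preimage: "compact {z \<in> D_star \<alpha>. ?f z \<in> K}" if K: "K \<subseteq> D_star \<beta>" "compact K" for K
  proof -
    have "bounded ((\<lambda>w. ln (cmod (fst w))) ` K)" "bounded ((\<lambda>w. ln (cmod (snd w))) ` K)"
      using K by (auto intro!: compact_imp_bounded compact_continuous_image continuous_intros
          simp: D_star_iff_ln)
    then obtain M1 M2 where M: "\<And>w. w \<in> K \<Longrightarrow> \<bar>ln (cmod (fst w))\<bar> \<le> M1"
        "\<And>w. w \<in> K \<Longrightarrow> \<bar>ln (cmod (snd w))\<bar> \<le> M2"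
      unfolding bounded_iff real_norm_def by blast
    \<comment> \<open>bound on the solution of the linear system, by the rows of the adjugate matrix\<close>
    define M where "M = ((\<bar>l2\<bar> * M1 + \<bar>k2\<bar> * M2) + (\<bar>l1\<bar> * M1 + \<bar>k1\<bar> * M2)) / \<bar>\<Delta>\<bar>"
    define A where "A = cball (0 :: complex) (exp M) - ball 0 (exp (- M))"
    have A_iff: "u \<in> A \<longleftrightarrow> u \<noteq> 0 \<and> \<bar>ln (cmod u)\<bar> \<le> M" for u
    proof (cases "u = 0")
      case False
      then have "u \<in> A \<longleftrightarrow> exp (- M) \<le> exp (ln (cmod u)) \<and> exp (ln (cmod u)) \<le> exp M"
        by (auto simp: A_def)
      with False show ?thesis by (auto simp del: exp_ln)
    qed (auto simp: A_def)
    have "{z \<in> D_star \<alpha>. ?f z \<in> K} = (A \<times> A) \<inter> ?f -` K"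
    proof (intro set_eqI iffI)
      fix z assume "z \<in> (A \<times> A) \<inter> ?f -` K"
      then show "z \<in> {z \<in> D_star \<alpha>. ?f z \<in> K}"
        using in_iff[of "fst z" "snd z"] K by (auto simp: A_iff)
    next
      fix z assume z: "z \<in> {z \<in> D_star \<alpha>. ?f z \<in> K}"
      obtain z1 z2 where z12: "z = (z1, z2)" by fastforce
      have nz: "z1 \<noteq> 0" "z2 \<noteq> 0" using z by (auto simp: z12 D_star_iff_ln)
      let ?x = "ln (cmod z1)" and ?y = "ln (cmod z2)"
      let ?p = "k1 * ?x + k2 * ?y" and ?q = "l1 * ?x + l2 * ?y"
      have pq: "\<bar>?p\<bar> \<le> M1" "\<bar>?q\<bar> \<le> M2"
        using M[of "?f z"] z ln_f[OF nz] by (auto simp: z12)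
      have bound: "\<bar>i * ?p + j * ?q\<bar> \<le> \<bar>i\<bar> * M1 + \<bar>j\<bar> * M2" for i j :: real
      proof -
        have "\<bar>i * ?p + j * ?q\<bar> \<le> \<bar>i * ?p\<bar> + \<bar>j * ?q\<bar>" by (rule abs_triangle_ineq)
        also have "\<dots> \<le> \<bar>i\<bar> * M1 + \<bar>j\<bar> * M2"
          unfolding abs_mult by (intro add_mono mult_left_mono pq abs_ge_zero)
        finally show ?thesis .
      qed
      have nn: "0 \<le> \<bar>i\<bar> * M1" "0 \<le> \<bar>i\<bar> * M2" for i :: real
        using pq by (auto intro!: mult_nonneg_nonneg)
      have "\<Delta> * ?x = real_of_int l2 * ?p + (- real_of_int k2) * ?q"
        by (simp add: \<Delta>_def algebra_simps)
      then have "\<bar>\<Delta> * ?x\<bar> \<le> (\<bar>l2\<bar> * M1 + \<bar>k2\<bar> * M2) + (\<bar>l1\<bar> * M1 + \<bar>k1\<bar> * M2)"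
        using bound[of "real_of_int l2" "- real_of_int k2"] nn(1)[of l1] nn(2)[of k1] by simp
      then have x: "\<bar>?x\<bar> \<le> M"
        using \<open>\<Delta> \<noteq> 0\<close> by (simp add: M_def pos_le_divide_eq abs_mult mult.commute)
      have "\<Delta> * ?y = (- real_of_int l1) * ?p + real_of_int k1 * ?q"
        by (simp add: \<Delta>_def algebra_simps)
      then have "\<bar>\<Delta> * ?y\<bar> \<le> (\<bar>l2\<bar> * M1 + \<bar>k2\<bar> * M2) + (\<bar>l1\<bar> * M1 + \<bar>k1\<bar> * M2)"
        using bound[of "- real_of_int l1" "real_of_int k1"] nn(1)[of l2] nn(2)[of k2] by simp
      then have y: "\<bar>?y\<bar> \<le> M"
        using \<open>\<Delta> \<noteq> 0\<close> by (simp add: M_def pos_le_divide_eq abs_mult mult.commute)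
      then show "z \<in> (A \<times> A) \<inter> ?f -` K"
        using z nz x y by (auto simp: z12 A_iff)
    qed
    moreover have AA: "compact (A \<times> A)"
      unfolding A_def by (intro compact_Times compact_diff compact_cball open_ball)
    moreover have "closed ((A \<times> A) \<inter> ?f -` K)"
    proof (rule continuous_closed_preimage)
      show "continuous_on (A \<times> A) ?f"
        by (intro continuous_intros) (auto simp: A_iff)
    qed (use AA K compact_imp_closed in auto)
    ultimately show ?thesis
      using compact_Int_closed[of "A \<times> A" "(A \<times> A) \<inter> ?f -` K"] by simp
  qed
  show ?thesis
    unfolding proper_holomorphic_iff_compact_preimages
    using hol preimage in_iff by (auto simp: D_star_iff_ln)
qed

section \<open>Existence and classification of proper maps\<close>

theorem theorem2:
  fixes \<alpha> \<beta> :: real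
  assumes "\<alpha> \<notin> \<rat>" and "\<beta> \<notin> \<rat>"
  shows "({f. proper_holomorphic (D_star \<alpha>) (D_star \<beta>) f} \<noteq> {} \<longleftrightarrow>
            (\<exists>k1 k2 l1 l2 :: int.
               real_of_int k1 + \<beta> * real_of_int l1 \<noteq> 0 \<and>
               \<alpha> = (real_of_int k2 + \<beta> * real_of_int l2) / (real_of_int k1 + \<beta> * real_of_int l1)))
       \<and> ((\<exists>k1 k2 l1 l2 :: int.
               real_of_int k1 + \<beta> * real_of_int l1 > 0 \<and>
               \<alpha> = (real_of_int k2 + \<beta> * real_of_int l2) / (real_of_int k1 + \<beta> * real_of_int l1))
          \<longrightarrow> (\<forall>f. proper_holomorphic (D_star \<alpha>) (D_star \<beta>) f \<longrightarrow>
                (\<exists>(k1 :: int) (k2 :: int) (l1 :: int) (l2 :: int) (a :: complex) (b :: complex).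
                   real_of_int k1 + \<beta> * real_of_int l1 > 0 \<and>
                   \<alpha> = (real_of_int k2 + \<beta> * real_of_int l2) / (real_of_int k1 + \<beta> * real_of_int l1) \<and>
                   cmod a * cmod b powr \<beta> = 1 \<and>
                   (\<forall>z1 z2. (z1, z2) \<in> D_star \<alpha> \<longrightarrow>
                      f (z1, z2) = (a * z1 powi k1 * z2 powi k2, b * z1 powi l1 * z2 powi l2)))))"
    (is "(_ \<longleftrightarrow> ?exponents) \<and> (_ \<longrightarrow> (\<forall>f. _ \<longrightarrow> ?monomial f))")
proof -
  have mono: "?monomial f" if f: "proper_holomorphic (D_star \<alpha>) (D_star \<beta>) f" for f
  proof -
    obtain k1 k2 l1 l2 :: int and a b :: complex where
      ab: "a \<noteq> 0" "b \<noteq> 0" and \<alpha>: "\<alpha> * (k1 + \<beta> * l1) = k2 + \<beta> * l2"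
      and form: "\<And>z1 z2. (z1, z2) \<in> D_star \<alpha> \<Longrightarrow>
        f (z1, z2) = (a * z1 powi k1 * z2 powi k2, b * z1 powi l1 * z2 powi l2)"
      by (rule proper_holomorphic_imp_monomial[OF assms(1) f]) blast
    note norm = proper_monomial_normalization[OF f ab form]
    have "\<alpha> = (k2 + \<beta> * l2) / (k1 + \<beta> * l1)"
      using \<alpha> norm(1) by (simp add: eq_divide_eq)
    with norm form show ?thesis by blast
  qed
  have "\<exists>f. proper_holomorphic (D_star \<alpha>) (D_star \<beta>) f" if exponents: ?exponents
  proof -
    obtain k1 k2 l1 l2 :: int where c: "k1 + \<beta> * l1 \<noteq> 0" and \<alpha>: "\<alpha> = (k2 + \<beta> * l2) / (k1 + \<beta> * l1)"
      using exponents by blast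
    have \<alpha>c: "\<alpha> * (k1 + \<beta> * l1) = k2 + \<beta> * l2" using c \<alpha> by simp
    show ?thesis
    proof (cases "k1 + \<beta> * l1 > 0")
      case True
      from proper_holomorphic_monomial[OF assms(1) this \<alpha>c] show ?thesis by blast
    next
      case False
      \<comment> \<open>negating all four exponents keeps the quotient and makes the denominator positive\<close>
      then have "real_of_int (- k1) + \<beta> * real_of_int (- l1) > 0" using c by simp
      moreover have "\<alpha> * (real_of_int (- k1) + \<beta> * real_of_int (- l1)) = real_of_int (- k2) + \<beta> * real_of_int (- l2)"
        using \<alpha>c by (simp add: algebra_simps)
      ultimately show ?thesis
        using proper_holomorphic_monomial[OF assms(1)] by blast
    qed
  qed
  moreover have ?exponents if "proper_holomorphic (D_star \<alpha>) (D_star \<beta>) f" for f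
    using mono[OF that] less_imp_neq by metis
  ultimately show ?thesis using mono by blast
qed

end
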